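(* The following two statements are equivalent. (a) For all $R_-\subseteq U$, $S_-\subseteq F$ and $\emptyset\ne T_-\subseteq C$, $$|R_-|+\sum_{i\in T_-}\Bigl(-\Bigl\lceil\tfrac{n}{k_0}\Bigr\rceil+|C_i|\Bigr)\le e(R_-,F\setminus S_-)+e(S_-\cap F^C,C\setminus T_-)+|U^0|\cdot e(S_-\cap F^0,C\setminus T_-).$$ (b) For all $\emptyset\ne T_-\subseteq C$ and all $S_-\subseteq F$ with $S_-\supseteq\delta^-(T_-)$ and $S_-\cap F^0=\delta^-(T_-)\cap F^0$, $$|R_-|+\sum_{i\in T_-}\Bigl(-\Bigl\lceil\tfrac{n}{k_0}\Bigr\rceil+|C_i|\Bigr)\le e(S_-\cap F^C,C\setminus T_-),\qquad\text{where } R_-=\{v\in U:\delta^+(v)\subseteq S_-\}.$$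
   Context: Let $G=(V,E)$ be a finite simple graph with $n=|V|$, and let $\Pi_p=(C_1,\dots,C_n)$ be a partial $k$-coloring: pairwise disjoint stable subsets of $V$ with $C_i=\emptyset$ for $i>k$. Let $U=V\setminus\bigcup_i C_i$ be the set of uncolored vertices and, for $v\in U$, let $F(v)=\{1,\dots,n\}\setminus\{i: C_i\text{ contains a neighbor of }v\}$ be its free colors. Let $1\le k_0\le n$. Let $U$ be the disjoint union of $U^0,U^1,\dots,U^l$ ($l\ge1$), where $U^1,\dots,U^l$ are pairwise non-adjacent cliques of $G$ and $U^0$ consists of the remaining uncolored vertices. Define a directed graph with vertex set $U\cup F\cup C$, where $C=\{1,\dots,k_0\}$, $F=\bigcup_{j=0}^l F^j$, and each $F^j=\{f^j(1),\dots,f^j(k_0)\}$ is a separate copy of $C$; put $F^C=\bigcup_{j=1}^l F^j$. Its arcs are $A_2=\bigcup_{j=0}^l\{(v,f^j(i)): v\in U^j,\ i\in F(v),\ 1\le i\le k_0\}$ and $A_3=\bigcup_{j=0}^l\{(f^j(i),i):1\le i\le k_0\}$. For a vertex set $W$, $\delta^+(W)$ is the set of heads of arcs with tail in $W$ (with $\delta^+(v)=\delta^+(\{v\})$) and $\delta^-(W)$ is the set of tails of arcs with head in $W$; $e(W_1,W_2)$ is the number of arcs with tail in $W_1$ and head in $W_2$. *)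

theory Defs
  imports "Graph_Theory.Pair_Digraph" "HOL-Library.Disjoint_Sets" Complex_Main
begin

text \<open>
  A finite simple graph is a \<^locale>\<open>pair_graph\<close>: a finite, loop-free digraph with a symmetric arc
  relation, each edge being represented by its two opposite arcs.
\<close>

abbreviation num_verts :: "'a pair_pre_digraph \<Rightarrow> nat" where
  "num_verts G \<equiv> card (pverts G)"

definition stable_set :: "'a pair_pre_digraph \<Rightarrow> 'a set \<Rightarrow> bool" where
  "stable_set G A \<longleftrightarrow> A \<subseteq> pverts G \<and> (\<forall>u\<in>A. \<forall>v\<in>A. (u, v) \<notin> parcs G)"

definition clique :: "'a pair_pre_digraph \<Rightarrow> 'a set \<Rightarrow> bool" where
  "clique G A \<longleftrightarrow> A \<subseteq> pverts G \<and> (\<forall>u\<in>A. \<forall>v\<in>A. u \<noteq> v \<longrightarrow> (u, v) \<in> parcs G)"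

definition nonadjacent :: "'a pair_pre_digraph \<Rightarrow> 'a set \<Rightarrow> 'a set \<Rightarrow> bool" where
  "nonadjacent G A B \<longleftrightarrow> (\<forall>u\<in>A. \<forall>v\<in>B. (u, v) \<notin> parcs G)"

text \<open>
  The tuple \<open>(C\<^sub>1, \<dots>, C\<^sub>n)\<close> is a function on \<^typ>\<open>nat\<close> of which only the values on \<open>{1..n}\<close> are used.
\<close>

definition partial_coloring :: "'a pair_pre_digraph \<Rightarrow> nat \<Rightarrow> (nat \<Rightarrow> 'a set) \<Rightarrow> bool" where
  "partial_coloring G k C \<longleftrightarrow>
     (\<forall>i\<in>{1..num_verts G}. stable_set G (C i)) \<and>
     disjoint_family_on C {1..num_verts G} \<and>
     (\<forall>i\<in>{1..num_verts G}. k < i \<longrightarrow> C i = {})"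

definition uncolored :: "'a pair_pre_digraph \<Rightarrow> (nat \<Rightarrow> 'a set) \<Rightarrow> 'a set" where
  "uncolored G C = pverts G - (\<Union>i\<in>{1..num_verts G}. C i)"

definition free_colors :: "'a pair_pre_digraph \<Rightarrow> (nat \<Rightarrow> 'a set) \<Rightarrow> 'a \<Rightarrow> nat set" where
  "free_colors G C v = {1..num_verts G} - {i. \<exists>u\<in>C i. (v, u) \<in> parcs G}"

text \<open>
  Here \<open>Us 0, \<dots>, Us l\<close> are the sets \<open>U\<^sup>0, \<dots>, U\<^sup>l\<close>.
\<close>

definition clique_partition ::
  "'a pair_pre_digraph \<Rightarrow> (nat \<Rightarrow> 'a set) \<Rightarrow> nat \<Rightarrow> (nat \<Rightarrow> 'a set) \<Rightarrow> bool" where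
  "clique_partition G C l Us \<longleftrightarrow>
     (\<Union>j\<in>{0..l}. Us j) = uncolored G C \<and>
     disjoint_family_on Us {0..l} \<and>
     (\<forall>j\<in>{1..l}. clique G (Us j)) \<and>
     (\<forall>i\<in>{1..l}. \<forall>j\<in>{1..l}. i \<noteq> j \<longrightarrow> nonadjacent G (Us i) (Us j))"

text \<open>
  The nodes of the auxiliary digraph: \<open>UNode v\<close> is the uncolored vertex \<open>v\<close>, \<open>FNode j i\<close> is
  \<open>f\<^sup>j(i)\<close>, and \<open>CNode i\<close> is the color \<open>i\<close>.
\<close>

datatype 'a node = UNode 'a | FNode nat nat | CNode nat

definition F_copy :: "nat \<Rightarrow> nat \<Rightarrow> 'a node set" where
  "F_copy k0 j = FNode j ` {1..k0}"

definition F_nodes :: "nat \<Rightarrow> nat \<Rightarrow> 'a node set" where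
  "F_nodes k0 l = (\<Union>j\<in>{0..l}. F_copy k0 j)"

definition FC_nodes :: "nat \<Rightarrow> nat \<Rightarrow> 'a node set" where
  "FC_nodes k0 l = (\<Union>j\<in>{1..l}. F_copy k0 j)"

definition color_digraph ::
  "'a pair_pre_digraph \<Rightarrow> (nat \<Rightarrow> 'a set) \<Rightarrow> nat \<Rightarrow> nat \<Rightarrow> (nat \<Rightarrow> 'a set) \<Rightarrow> 'a node pair_pre_digraph"
where
  "color_digraph G C k0 l Us =
     \<lparr> pverts = UNode ` uncolored G C \<union> F_nodes k0 l \<union> CNode ` {1..k0},
       parcs =
         (\<Union>j\<in>{0..l}. {(UNode v, FNode j i) | v i. v \<in> Us j \<and> i \<in> free_colors G C v \<and> i \<in> {1..k0}}) \<union>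
         (\<Union>j\<in>{0..l}. {(FNode j i, CNode i) | i. i \<in> {1..k0}}) \<rparr>"

definition out_nbrs :: "'b pair_pre_digraph \<Rightarrow> 'b set \<Rightarrow> 'b set" where
  "out_nbrs D W = parcs D `` W"

definition in_nbrs :: "'b pair_pre_digraph \<Rightarrow> 'b set \<Rightarrow> 'b set" where
  "in_nbrs D W = (parcs D)\<inverse> `` W"

definition num_arcs :: "'b pair_pre_digraph \<Rightarrow> 'b set \<Rightarrow> 'b set \<Rightarrow> nat" where
  "num_arcs D W1 W2 = card {a \<in> parcs D. fst a \<in> W1 \<and> snd a \<in> W2}"

end

theory Submission
  imports Defs
begin

text \<open>
  Statement (b) is the instance of (a) in which, for a given \<open>T\<close>, the set \<open>S\<close> contains every copy
  of every color of \<open>T\<close> and meets \<open>F\<^sup>0\<close> in nothing else, and \<open>R\<close> is the largest set of vertices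
  sending no arc out of \<open>S\<close>.  For such triples the first and the last term on the right of (a)
  vanish, whence (a) implies (b).

  Conversely, any \<open>S\<close> is normalized to \<open>S' = (S \<inter> F\<^sup>C) \<union> \<delta>\<^sup>-(T)\<close>.  Since a copy of a color has that
  color as its only out-neighbor, the added copies send no arc to \<open>C - T\<close>, and the second term on
  the right does not change (\<open>num_arcs_normalize\<close>).  So (b) for \<open>S'\<close> and \<open>T\<close> gives (a) once it is known
  that replacing \<open>R\<close> by \<open>R' = {v. \<delta>\<^sup>+(v) \<subseteq> S'}\<close> loses no more vertices than the first and the last
  term together (\<open>card_le_card_closed\<close>).  A vertex of \<open>R\<close> outside \<open>R'\<close> sends an arc to some node
  \<open>f \<notin> S'\<close>.  If \<open>f \<notin> S\<close>, the arc is counted by the first term.  If \<open>f \<in> S\<close>, then \<open>f\<close> was removed by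
  the normalization, that is, \<open>f\<close> lies in \<open>F\<^sup>0\<close> and is a copy of a color outside \<open>T\<close>; then the vertex
  lies in \<open>U\<^sup>0\<close> and the arc leaving \<open>f\<close> makes the last term at least \<open>card U\<^sup>0\<close>, which pays for all
  vertices of this kind at once.
\<close>

lemma arc_color_digraph_iff:
  "(x, y) \<in> parcs (color_digraph G C k0 l Us) \<longleftrightarrow>
     (\<exists>v j i. x = UNode v \<and> y = FNode j i \<and> j \<le> l \<and> v \<in> Us j \<and> i \<in> free_colors G C v \<and> i \<in> {1..k0})
     \<or> (\<exists>j i. x = FNode j i \<and> y = CNode i \<and> j \<le> l \<and> i \<in> {1..k0})"
  unfolding color_digraph_def by auto

lemma FNode_in_F_copy_iff [simp]: "FNode j i \<in> F_copy k0 j' \<longleftrightarrow> j = j' \<and> i \<in> {1..k0}"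
  unfolding F_copy_def by auto

lemma FNode_in_F_nodes_iff [simp]: "FNode j i \<in> F_nodes k0 l \<longleftrightarrow> j \<le> l \<and> i \<in> {1..k0}"
  unfolding F_nodes_def by auto

lemma FNode_in_FC_nodes_iff [simp]: "FNode j i \<in> FC_nodes k0 l \<longleftrightarrow> 1 \<le> j \<and> j \<le> l \<and> i \<in> {1..k0}"
  unfolding FC_nodes_def by auto

lemma FC_nodes_subset: "FC_nodes k0 l \<subseteq> F_nodes k0 l"
  unfolding FC_nodes_def F_nodes_def by fastforce

lemma FC_nodes_Int_F_copy_0: "FC_nodes k0 l \<inter> F_copy k0 0 = {}"
  unfolding FC_nodes_def F_copy_def by auto

lemma finite_parcs_color_digraph:
  assumes "\<And>j. j \<le> l \<Longrightarrow> finite (Us j)"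
  shows "finite (parcs (color_digraph G C k0 l Us))"
proof (rule finite_subset)
  let ?E = "UNode ` (\<Union>j\<le>l. Us j) \<union> F_nodes k0 l \<union> CNode ` {1..k0}"
  show "parcs (color_digraph G C k0 l Us) \<subseteq> ?E \<times> ?E"
  proof (rule subrelI)
    fix x y :: "'a node"
    assume "(x, y) \<in> parcs (color_digraph G C k0 l Us)"
    then consider v j i where "x = UNode v" "y = FNode j i" "j \<le> l" "v \<in> Us j" "i \<in> {1..k0}"
      | j i where "x = FNode j i" "y = CNode i" "j \<le> l" "i \<in> {1..k0}"
      unfolding arc_color_digraph_iff by blast
    then show "(x, y) \<in> ?E \<times> ?E"
    proof cases
      case 1
      then have "x \<in> UNode ` (\<Union>j\<le>l. Us j)"
        by blast
      with 1 show ?thesis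
        by simp
    qed simp
  qed
  show "finite (?E \<times> ?E)"
    using assms by (auto simp: F_nodes_def F_copy_def)
qed

lemma in_nbrs_colors:
  assumes "T \<subseteq> {1..k0}"
  shows "in_nbrs (color_digraph G C k0 l Us) (CNode ` T) = {FNode j i | j i. j \<le> l \<and> i \<in> T}"
  using assms by (fastforce simp: in_nbrs_def arc_color_digraph_iff)

lemma num_arcs_normalize:
  fixes G C k0 l Us
  defines "D \<equiv> color_digraph G C k0 l Us"
  assumes "T \<subseteq> {1..k0}"
  shows "num_arcs D ((S \<inter> FC \<union> in_nbrs D (CNode ` T)) \<inter> FC) (CNode ` ({1..k0} - T))
       = num_arcs D (S \<inter> FC) (CNode ` ({1..k0} - T))"
proof -
  have "fst a \<notin> in_nbrs D (CNode ` T)"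
    if "a \<in> parcs D" "snd a \<in> CNode ` ({1..k0} - T)" for a
    using that assms(2) unfolding D_def
    by (cases a) (auto simp: in_nbrs_colors arc_color_digraph_iff)
  then have "{a \<in> parcs D. fst a \<in> (S \<inter> FC \<union> in_nbrs D (CNode ` T)) \<inter> FC
                         \<and> snd a \<in> CNode ` ({1..k0} - T)}
           = {a \<in> parcs D. fst a \<in> S \<inter> FC \<and> snd a \<in> CNode ` ({1..k0} - T)}"
    by blast
  then show ?thesis
    unfolding num_arcs_def by simp
qed

text \<open>
  The product with \<open>card (Us 0)\<close> is the price of removing from \<open>S\<close> the copies in \<open>F\<^sup>0\<close> of colors
  outside \<open>T\<close>: only vertices of \<open>Us 0\<close> have an arc to such a copy, so a single removed copy already
  accounts for every vertex affected.
\<close>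

lemma card_le_card_closed:
  fixes G C k0 l Us T S
  defines "D \<equiv> color_digraph G C k0 l Us"
  defines "S' \<equiv> S \<inter> FC_nodes k0 l \<union> in_nbrs D (CNode ` T)"
  assumes "T \<subseteq> {1..k0}" and "finite U" and "R \<subseteq> U" and "\<And>j. j \<le> l \<Longrightarrow> finite (Us j)"
  shows "card R \<le> card {v \<in> U. out_nbrs D {UNode v} \<subseteq> S'}
               + num_arcs D (UNode ` R) (F_nodes k0 l - S)
               + card (Us 0) * num_arcs D (S \<inter> F_copy k0 0) (CNode ` ({1..k0} - T))"
proof -
  let ?R' = "{v \<in> U. out_nbrs D {UNode v} \<subseteq> S'}"
  let ?A = "{a \<in> parcs D. fst a \<in> UNode ` R \<and> snd a \<in> F_nodes k0 l - S}"
  let ?B = "{a \<in> parcs D. fst a \<in> S \<inter> F_copy k0 0 \<and> snd a \<in> CNode ` ({1..k0} - T)}"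
  let ?X = "{v. UNode v \<in> fst ` ?A}"
  define Z where "Z = (if ?B = {} then {} else Us 0)"
  have fin: "finite (parcs D)"
    unfolding D_def by (rule finite_parcs_color_digraph) (rule assms(6))
  then have finA: "finite ?A" and finB: "finite ?B"
    by auto
  have inj: "inj (UNode :: 'a \<Rightarrow> 'a node)"
    by (simp add: inj_def)
  have "R \<subseteq> ?R' \<union> ?X \<union> Z"
  proof
    fix v assume v: "v \<in> R"
    show "v \<in> ?R' \<union> ?X \<union> Z"
    proof (cases "v \<in> ?R'")
      case False
      with v \<open>R \<subseteq> U\<close> obtain x where x: "(UNode v, x) \<in> parcs D" "x \<notin> S'"
        by (auto simp: out_nbrs_def)
      then obtain j i where ji: "x = FNode j i" "j \<le> l" "v \<in> Us j" "i \<in> {1..k0}"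
        unfolding D_def by (auto simp: arc_color_digraph_iff)
      show ?thesis
      proof (cases "x \<in> S")
        case False
        then have "(UNode v, x) \<in> ?A"
          using v x ji by auto
        then show ?thesis
          by force
      next
        case True
        with x ji have "j = 0"
          by (auto simp: S'_def)
        have "i \<notin> T"
          using x ji assms(3) by (auto simp: S'_def D_def in_nbrs_colors)
        then have "(x, CNode i) \<in> ?B"
          using True ji \<open>j = 0\<close> by (auto simp: D_def arc_color_digraph_iff)
        then have "Z = Us 0"
          unfolding Z_def by (metis empty_iff)
        then show ?thesis
          using ji(3) \<open>j = 0\<close> by simp
      qed
    qed simp
  qed
  moreover have "finite (?R' \<union> ?X \<union> Z)"
  proof -
    have "finite ?X"
      using finite_vimageI[OF finite_imageI[OF finA] inj] by (simp only: vimage_def)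
    moreover have "finite Z"
      using assms(6)[of 0] by (simp add: Z_def)
    ultimately show ?thesis
      using \<open>finite U\<close> by simp
  qed
  ultimately have "card R \<le> card (?R' \<union> ?X \<union> Z)"
    by (rule card_mono[rotated])
  moreover have "card (?R' \<union> ?X \<union> Z) \<le> card ?R' + card ?X + card Z"
    by (rule order_trans[OF card_Un_le add_right_mono[OF card_Un_le]])
  moreover have "card ?X \<le> card ?A"
  proof -
    have "card ?X = card (UNode ` ?X)"
      by (rule card_image[symmetric]) (rule inj_on_subset[OF inj subset_UNIV])
    also have "\<dots> \<le> card (fst ` ?A)"
      by (rule card_mono[OF finite_imageI[OF finA]]) blast
    also have "\<dots> \<le> card ?A"
      using finA by (rule card_image_le)
    finally show ?thesis .
  qed
  moreover have "card Z \<le> card (Us 0) * card ?B"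
  proof (cases "?B = {}")
    case True
    then have "Z = {}"
      unfolding Z_def by (rule if_P)
    then show ?thesis
      by simp
  next
    case False
    then have "Z = Us 0"
      unfolding Z_def by (rule if_not_P)
    moreover have "1 \<le> card ?B"
      using False finB by (simp only: Suc_le_eq One_nat_def card_gt_0_iff simp_thms)
    then have "card (Us 0) * 1 \<le> card (Us 0) * card ?B"
      by (rule mult_le_mono2)
    ultimately show ?thesis
      by (simp only: mult_1_right)
  qed
  ultimately show ?thesis
    unfolding num_arcs_def by linarith
qed

theorem mainTheorem11:
  fixes G :: "'a pair_pre_digraph"
    and C Us :: "nat \<Rightarrow> 'a set"
    and k k0 l n :: nat
    and U :: "'a set"
    and F FC :: "'a node set"
    and D :: "'a node pair_pre_digraph"
  assumes graph: "pair_graph G"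
    and n_def: "n = num_verts G"
    and coloring: "partial_coloring G k C"
    and k0: "1 \<le> k0" "k0 \<le> n"
    and l: "1 \<le> l"
    and U_def: "U = uncolored G C"
    and partition: "clique_partition G C l Us"
    and F_def: "F = F_nodes k0 l"
    and FC_def: "FC = FC_nodes k0 l"
    and D_def: "D = color_digraph G C k0 l Us"
  shows
    "(\<forall>R S T. R \<subseteq> U \<and> S \<subseteq> F \<and> T \<subseteq> {1..k0} \<and> T \<noteq> {} \<longrightarrow>
        int (card R) + (\<Sum>i\<in>T. - \<lceil>real n / real k0\<rceil> + int (card (C i)))
          \<le> int (num_arcs D (UNode ` R) (F - S))
            + int (num_arcs D (S \<inter> FC) (CNode ` ({1..k0} - T)))
            + int (card (Us 0)) * int (num_arcs D (S \<inter> F_copy k0 0) (CNode ` ({1..k0} - T))))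
     \<longleftrightarrow>
     (\<forall>S T. T \<subseteq> {1..k0} \<and> T \<noteq> {} \<and> S \<subseteq> F
          \<and> in_nbrs D (CNode ` T) \<subseteq> S
          \<and> S \<inter> F_copy k0 0 = in_nbrs D (CNode ` T) \<inter> F_copy k0 0 \<longrightarrow>
        int (card {v \<in> U. out_nbrs D {UNode v} \<subseteq> S})
            + (\<Sum>i\<in>T. - \<lceil>real n / real k0\<rceil> + int (card (C i)))
          \<le> int (num_arcs D (S \<inter> FC) (CNode ` ({1..k0} - T))))"
proof -
  have fin: "finite U"
  proof -
    interpret pair_graph G
      by (rule graph)
    show ?thesis
      unfolding U_def uncolored_def by (rule finite_Diff) (rule pair_finite_verts)
  qed
  have finUs: "\<And>j. j \<le> l \<Longrightarrow> finite (Us j)"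
  proof -
    fix j assume "j \<le> l"
    then have "Us j \<subseteq> U"
      using partition unfolding clique_partition_def U_def by fastforce
    then show "finite (Us j)"
      using fin by (rule finite_subset)
  qed
  show ?thesis (is "?a \<longleftrightarrow> ?b")
  proof
    assume a: ?a
    show ?b
    proof (intro allI impI, elim conjE)
      fix S T
      assume T: "T \<subseteq> {1..k0}" "T \<noteq> {}" and S: "S \<subseteq> F"
        and S0: "S \<inter> F_copy k0 0 = in_nbrs D (CNode ` T) \<inter> F_copy k0 0"
      let ?R = "{v \<in> U. out_nbrs D {UNode v} \<subseteq> S}"
      have none: "{a \<in> parcs D. fst a \<in> UNode ` ?R \<and> snd a \<in> F - S} = {}"
        by (auto simp: out_nbrs_def)
      have none0: "{a \<in> parcs D. fst a \<in> S \<inter> F_copy k0 0 \<and> snd a \<in> CNode ` ({1..k0} - T)} = {}"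
        unfolding S0 using T by (auto simp: D_def in_nbrs_colors arc_color_digraph_iff)
      have "?R \<subseteq> U"
        by blast
      then show "int (card ?R) + (\<Sum>i\<in>T. - \<lceil>real n / real k0\<rceil> + int (card (C i)))
          \<le> int (num_arcs D (S \<inter> FC) (CNode ` ({1..k0} - T)))"
        using a[rule_format, of ?R S T] T S
        unfolding num_arcs_def none none0 by simp
    qed
  next
    assume b: ?b
    show ?a
    proof (intro allI impI, elim conjE)
      fix R S T
      assume R: "R \<subseteq> U" and T: "T \<subseteq> {1..k0}" "T \<noteq> {}"
      let ?S' = "S \<inter> FC \<union> in_nbrs D (CNode ` T)"
      have "?S' \<subseteq> F"
        using FC_nodes_subset T
        by (fastforce simp: F_def FC_def D_def in_nbrs_colors)
      moreover have "?S' \<inter> F_copy k0 0 = in_nbrs D (CNode ` T) \<inter> F_copy k0 0"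
        using FC_nodes_Int_F_copy_0 unfolding FC_def by blast
      ultimately have
        "int (card {v \<in> U. out_nbrs D {UNode v} \<subseteq> ?S'})
            + (\<Sum>i\<in>T. - \<lceil>real n / real k0\<rceil> + int (card (C i)))
          \<le> int (num_arcs D (?S' \<inter> FC) (CNode ` ({1..k0} - T)))"
        using b T by blast
      also have "\<dots> = int (num_arcs D (S \<inter> FC) (CNode ` ({1..k0} - T)))"
        unfolding D_def using num_arcs_normalize[OF T(1)] by simp
      finally have main:
        "int (card {v \<in> U. out_nbrs D {UNode v} \<subseteq> ?S'})
            + (\<Sum>i\<in>T. - \<lceil>real n / real k0\<rceil> + int (card (C i)))
          \<le> int (num_arcs D (S \<inter> FC) (CNode ` ({1..k0} - T)))" .
      have "card R \<le> card {v \<in> U. out_nbrs D {UNode v} \<subseteq> ?S'} + num_arcs D (UNode ` R) (F - S)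
          + card (Us 0) * num_arcs D (S \<inter> F_copy k0 0) (CNode ` ({1..k0} - T))"
        unfolding D_def F_def FC_def by (rule card_le_card_closed[OF T(1) fin R]) (rule finUs)
      then have "int (card R) \<le> int (card {v \<in> U. out_nbrs D {UNode v} \<subseteq> ?S'})
          + int (num_arcs D (UNode ` R) (F - S))
          + int (card (Us 0)) * int (num_arcs D (S \<inter> F_copy k0 0) (CNode ` ({1..k0} - T)))"
        by (simp only: of_nat_le_iff flip: of_nat_add of_nat_mult)
      with main show "int (card R) + (\<Sum>i\<in>T. - \<lceil>real n / real k0\<rceil> + int (card (C i)))
          \<le> int (num_arcs D (UNode ` R) (F - S))
            + int (num_arcs D (S \<inter> FC) (CNode ` ({1..k0} - T)))
            + int (card (Us 0)) * int (num_arcs D (S \<inter> F_copy k0 0) (CNode ` ({1..k0} - T)))"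
        by linarith
    qed
  qed
qed

end
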